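(* Let $n\ge 1$ be an integer. Among all rooted trees with $n$ vertices, the rooted star $S_n$ uniquely minimises the level spectral radius; that is, for every rooted tree $T$ with $n$ vertices, $\rho_L(T)\ge \rho_L(S_n)$, with equality if and only if $T$ is (isomorphic as a rooted tree to) $S_n$. Moreover, $\rho_L(S_n)=\sqrt{n-1}$.
   Context: A rooted tree is a finite tree with a distinguished vertex (the root). The level $l(v)$ of a vertex $v$ is its distance from the root. For a rooted tree $T$ with vertices $v_1,\dots,v_n$, the level matrix $L(T)=(l_{ij})$ is the $n\times n$ real symmetric matrix with $l_{ij}=|l(v_i)-l(v_j)|$. The level spectral radius $\rho_L(T)$ is the largest absolute value of an eigenvalue of $L(T)$. The rooted star $S_n$ is the $n$-vertex star whose root is the central vertex (i.e. all $n-1$ non-root vertices are adjacent to the root). *)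

theory Defs
  imports "Graph_Theory.Graph_Theory" "Jordan_Normal_Form.Spectral_Radius"
begin

text \<open>
  An undirected graph is a symmetric digraph, each edge being a pair of opposite arcs. In this
  encoding the back-and-forth closed walk along an edge counts as a \<^const>\<open>pre_digraph.cycle\<close> (of
  length 2), so \<^const>\<open>tree\<close> is not the right notion for symmetric digraphs: the cycles of the
  undirected graph are the cycles of length at least 3.
\<close>

locale rooted_tree = pair_graph T for T :: "'a pair_pre_digraph" +
  fixes r :: 'a
  assumes root_in_verts: "r \<in> pverts T"
    and connected_tree: "connected (with_proj T)"
    and no_cycles: "\<not> (\<exists>p. cycle p \<and> length p \<ge> 3)"

definition level :: "'a pair_pre_digraph \<Rightarrow> 'a \<Rightarrow> 'a \<Rightarrow> nat" where
  "level T r v = (LEAST k. \<exists>p. pre_digraph.awalk (with_proj T) r p v \<and> length p = k)"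

definition level_matrix :: "'a pair_pre_digraph \<Rightarrow> 'a \<Rightarrow> 'a list \<Rightarrow> real mat" where
  "level_matrix T r vs = mat (length vs) (length vs)
     (\<lambda>(i, j). \<bar>real (level T r (vs ! i)) - real (level T r (vs ! j))\<bar>)"

text \<open>
  The enumeration of the vertices is arbitrary; see \<open>level_spectral_radius_enum\<close> below for the
  independence of this choice. The library's \<^const>\<open>spectral_radius\<close> is stated for complex
  matrices, hence the embedding.
\<close>

definition level_spectral_radius :: "'a pair_pre_digraph \<Rightarrow> 'a \<Rightarrow> real" where
  "level_spectral_radius T r = spectral_radius (map_mat complex_of_real
     (level_matrix T r (SOME vs. distinct vs \<and> set vs = pverts T)))"

text \<open>The root of the star is the vertex 0.\<close>

definition rooted_star :: "nat \<Rightarrow> nat pair_pre_digraph" where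
  "rooted_star n = \<lparr> pverts = {0..<n}, parcs = {0} \<times> {1..<n} \<union> {1..<n} \<times> {0} \<rparr>"

text \<open>As \<^const>\<open>digraph_iso\<close>, with the additional requirement that the root is preserved.\<close>

definition rooted_iso ::
    "'a pair_pre_digraph \<Rightarrow> 'a \<Rightarrow> 'b pair_pre_digraph \<Rightarrow> 'b \<Rightarrow> bool" where
  "rooted_iso T r T' r' \<longleftrightarrow>
     (\<exists>h. pre_digraph.digraph_isomorphism (with_proj T) h \<and>
          with_proj T' = app_iso h (with_proj T) \<and> iso_verts h r = r')"


lemma eigenvalue_level_matrix_enum:
  assumes vs: "distinct vs" and ws: "distinct ws" and set_eq: "set vs = set ws"
    and ev: "eigenvalue (map_mat complex_of_real (level_matrix T r vs)) k"
  shows "eigenvalue (map_mat complex_of_real (level_matrix T r ws)) k"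
proof -
  let ?n = "length vs"
  let ?g = "\<lambda>x y. complex_of_real \<bar>real (level T r x) - real (level T r y)\<bar>"
  have len: "length ws = ?n"
    using vs ws set_eq by (metis distinct_card)
  have bij_vs: "bij_betw ((!) vs) {0..<?n} (set vs)"
    using vs by (simp add: bij_betw_nth atLeast0LessThan)
  have bij_ws: "bij_betw ((!) ws) {0..<?n} (set vs)"
    using ws len set_eq by (simp add: bij_betw_nth atLeast0LessThan)
  define idx where "idx = the_inv_into {0..<?n} ((!) vs)"
  have idx: "idx (vs ! j) = j" if "j < ?n" for j
    unfolding idx_def using that bij_vs by (intro the_inv_into_f_f) (auto simp: bij_betw_def)
  have idx_in: "idx x < ?n" "vs ! idx x = x" if "x \<in> set vs" for x
    using that idx by (metis in_set_conv_nth)+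
  from ev obtain v where v: "v \<in> carrier_vec ?n" "v \<noteq> 0\<^sub>v ?n"
    and Av: "map_mat complex_of_real (level_matrix T r vs) *\<^sub>v v = k \<cdot>\<^sub>v v"
    unfolding eigenvalue_def eigenvector_def by (auto simp: level_matrix_def)
  have row: "(\<Sum>x\<in>set vs. ?g (vs ! i) x * v $ idx x) = k * v $ i" if i: "i < ?n" for i
  proof -
    have "(\<Sum>x\<in>set vs. ?g (vs ! i) x * v $ idx x)
        = (\<Sum>j\<in>{0..<?n}. ?g (vs ! i) (vs ! j) * v $ idx (vs ! j))"
      by (rule sum.reindex_bij_betw[OF bij_vs, symmetric])
    also have "\<dots> = (\<Sum>j\<in>{0..<?n}. ?g (vs ! i) (vs ! j) * v $ j)"
      using idx by (intro sum.cong) auto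
    also have "\<dots> = (map_mat complex_of_real (level_matrix T r vs) *\<^sub>v v) $ i"
      using i v by (simp add: level_matrix_def scalar_prod_def)
    also have "\<dots> = k * v $ i"
      using Av i v by simp
    finally show ?thesis .
  qed
  define w where "w = vec ?n (\<lambda>j. v $ idx (ws ! j))"
  have "map_mat complex_of_real (level_matrix T r ws) *\<^sub>v w = k \<cdot>\<^sub>v w"
  proof (rule eq_vecI)
    fix i assume "i < dim_vec (k \<cdot>\<^sub>v w)"
    hence i: "i < ?n" by (simp add: w_def)
    hence wsi: "ws ! i \<in> set vs" using len set_eq by simp
    have "(map_mat complex_of_real (level_matrix T r ws) *\<^sub>v w) $ i
        = (\<Sum>j\<in>{0..<?n}. ?g (ws ! i) (ws ! j) * v $ idx (ws ! j))"
      using i len by (simp add: level_matrix_def scalar_prod_def w_def)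
    also have "\<dots> = (\<Sum>x\<in>set vs. ?g (ws ! i) x * v $ idx x)"
      by (rule sum.reindex_bij_betw[OF bij_ws])
    also have "\<dots> = k * v $ idx (ws ! i)"
      using row[OF idx_in(1)[OF wsi]] idx_in(2)[OF wsi] by simp
    finally show "(map_mat complex_of_real (level_matrix T r ws) *\<^sub>v w) $ i = (k \<cdot>\<^sub>v w) $ i"
      using i by (simp add: w_def)
  qed (simp add: w_def level_matrix_def len)
  moreover have "w \<noteq> 0\<^sub>v ?n"
  proof -
    obtain i where i: "i < ?n" "v $ i \<noteq> 0"
      using v by (metis carrier_vecD eq_vecI index_zero_vec(1,2))
    obtain j where j: "j < ?n" "ws ! j = vs ! i"
      using i(1) len set_eq by (metis in_set_conv_nth nth_mem)
    have "w $ j = v $ i"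
      using i(1) j idx by (simp add: w_def)
    with i(2) j(1) show ?thesis by auto
  qed
  ultimately have "eigenvector (map_mat complex_of_real (level_matrix T r ws)) w k"
    by (simp add: eigenvector_def level_matrix_def len w_def)
  thus ?thesis unfolding eigenvalue_def by blast
qed

lemma level_spectral_radius_enum:
  assumes "distinct vs" "set vs = pverts T"
  shows "level_spectral_radius T r = spectral_radius (map_mat complex_of_real (level_matrix T r vs))"
proof -
  define ws where "ws = (SOME vs. distinct vs \<and> set vs = pverts T)"
  have "distinct ws \<and> set ws = pverts T"
    unfolding ws_def by (rule someI[of _ vs]) (use assms in blast)
  with assms have "spectrum (map_mat complex_of_real (level_matrix T r ws))
      = spectrum (map_mat complex_of_real (level_matrix T r vs))"
    unfolding spectrum_def
    using eigenvalue_level_matrix_enum[of vs ws T r] eigenvalue_level_matrix_enum[of ws vs T r]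
    by auto
  thus ?thesis
    unfolding level_spectral_radius_def spectral_radius_def ws_def by simp
qed

lemma card_rooted_star: "card (pverts (rooted_star n)) = n"
  by (simp add: rooted_star_def)

lemma rooted_tree_rooted_star:
  assumes "n \<ge> 1"
  shows "rooted_tree (rooted_star n) 0"
proof -
  interpret S: pair_graph "rooted_star n"
    by unfold_locales (auto simp: rooted_star_def symmetric_def sym_def)
  have arcD: "(fst e = 0) \<noteq> (snd e = 0)" if "e \<in> parcs (rooted_star n)" for e
    using that by (auto simp: rooted_star_def)
  show ?thesis
  proof unfold_locales
    show "0 \<in> pverts (rooted_star n)"
      using assms by (simp add: rooted_star_def)
    have 0: "0 \<in> verts (with_proj (rooted_star n))"
      using assms by (simp add: rooted_star_def)
    have to: "u \<rightarrow>\<^sup>*\<^bsub>with_proj (rooted_star n)\<^esub> 0" if "u \<in> pverts (rooted_star n)" for u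
    proof (cases "u = 0")
      case True
      thus ?thesis using S.reachable_refl[of 0] 0 by simp
    next
      case False
      thus ?thesis using that by (intro S.reachable_adjI) (simp add: rooted_star_def)
    qed
    have "strongly_connected (with_proj (rooted_star n))"
      unfolding strongly_connected_def
    proof (intro conjI ballI)
      fix u v assume "u \<in> verts (with_proj (rooted_star n))" "v \<in> verts (with_proj (rooted_star n))"
      hence "u \<rightarrow>\<^sup>*\<^bsub>with_proj (rooted_star n)\<^esub> 0" "0 \<rightarrow>\<^sup>*\<^bsub>with_proj (rooted_star n)\<^esub> v"
        using to symmetric_reachable[OF S.sym_arcs] by simp_all
      thus "u \<rightarrow>\<^sup>*\<^bsub>with_proj (rooted_star n)\<^esub> v" by (rule S.reachable_trans)
    qed (use 0 in blast)
    moreover have "mk_symmetric (with_proj (rooted_star n)) = rooted_star n"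
      by (rule pair_pre_digraph.equality) (auto simp: mk_symmetric_def rooted_star_def)
    ultimately show "connected (with_proj (rooted_star n))"
      by (simp add: connected_def)
    show "\<not> (\<exists>p. S.cycle p \<and> length p \<ge> 3)"
    proof
      assume "\<exists>p. S.cycle p \<and> length p \<ge> 3"
      then obtain p u where p: "S.awalk u p u" "distinct (tl (S.awalk_verts u p))" "length p \<ge> 3"
        unfolding S.cycle_def by blast
      then obtain a b c q where q: "p = a # b # c # q"
        by (auto simp: numeral_3_eq_3 Suc_le_length_iff)
      from p(1) have arcs: "a \<in> parcs (rooted_star n)" "b \<in> parcs (rooted_star n)"
          "c \<in> parcs (rooted_star n)" "set q \<subseteq> parcs (rooted_star n)"
        and ends: "fst a = u" "fst b = snd a" "fst c = snd b" "pcas (snd c) q u"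
        unfolding S.awalk_def q by auto
      show False
      proof (cases q)
        case Nil
        with ends arcs arcD[of a] arcD[of b] arcD[of c] show False by auto
      next
        case (Cons d q')
        with ends p(2) arcs arcD[of a] arcD[of b] arcD[of c] arcD[of d] show False
          unfolding q by (cases q') auto
      qed
    qed
  qed
qed

end

theory Submission
  imports Defs
begin

text \<open>
  Let \<open>s\<close> be the sum of the levels of a rooted tree \<open>T\<close> with \<open>n\<close> vertices. Every vertex other
  than the root has level at least 1, so \<open>s \<ge> n - 1\<close>, and equality means that every such vertex
  has level exactly 1. The whole argument rests on the bound \<open>\<rho>\<^sub>L(T) \<ge> \<surd>s\<close>: it gives the minimality
  of the star and its uniqueness at once, because \<open>s\<close> exceeds \<open>n - 1\<close> as soon as some level
  exceeds 1.

  For the bound, give the root the weight \<open>\<surd>s\<close> and all other vertices the weight 1. The level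
  matrix maps this vector to one that dominates \<open>\<surd>s\<close> times it: in the row of the root, the entries
  are the levels and sum to \<open>s = \<surd>s * \<surd>s\<close>; in the row of any other vertex, the entry in the column
  of the root is at least 1 and already contributes \<open>\<surd>s\<close>. The inequality of Collatz and Wielandt
  (\<open>Collatz_Wielandt_lower_bound\<close>) turns this into a bound for the spectral radius
  (\<open>sqrt_sum_levels_le_level_spectral_radius\<close>).

  When all levels are at most 1, the level matrix is the adjacency matrix of the star, whose
  eigenvalues \<open>k\<close> satisfy \<open>k\<^sup>2 = n - 1\<close> or \<open>k = 0\<close>; hence \<open>\<rho>\<^sub>L(T) = \<surd>(n - 1)\<close>
  (\<open>level_spectral_radius_of_levels_le_1\<close>). Finally, a rooted tree with all levels at most 1 is a
  star: every other vertex is adjacent to the root, and a further edge would close a triangle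
  (\<open>rooted_iso_star_iff\<close>).
\<close>

section \<open>A lower bound for the spectral radius of a nonnegative matrix\<close>

lemma mult_mat_vec_index_sum:
  assumes "A \<in> carrier_mat n n" "x \<in> carrier_vec n" "i < n"
  shows "(A *\<^sub>v x) $ i = (\<Sum>j = 0..<n. A $$ (i, j) * x $ j)"
  using assms by (simp add: scalar_prod_def)

lemma spectral_radius_nonneg:
  assumes "A \<in> carrier_mat n n" "n > 0"
  shows "spectral_radius A \<ge> 0"
  using spectral_radius_mem_max(1)[OF assms] by auto

lemma spectral_radius_scaled_lt_1:
  fixes A :: "complex mat"
  assumes A: "A \<in> carrier_mat n n" and n: "n > 0"
    and d: "spectral_radius A < d"
  shows "spectral_radius (complex_of_real (1 / d) \<cdot>\<^sub>m A) < 1"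
proof -
  let ?B = "complex_of_real (1 / d) \<cdot>\<^sub>m A"
  have d0: "d > 0"
    using spectral_radius_nonneg[OF A n] d by simp
  have B: "?B \<in> carrier_mat n n" using A by simp
  obtain k where k: "k \<in> spectrum ?B" "spectral_radius ?B = norm k"
    using spectral_radius_mem_max(1)[OF B n] by auto
  then obtain v where v: "v \<in> carrier_vec n" "v \<noteq> 0\<^sub>v n" "?B *\<^sub>v v = k \<cdot>\<^sub>v v"
    using B unfolding spectrum_def eigenvalue_def eigenvector_def by auto
  have "A *\<^sub>v v = (of_real d * k) \<cdot>\<^sub>v v"
  proof (rule eq_vecI)
    fix i assume "i < dim_vec ((of_real d * k) \<cdot>\<^sub>v v)"
    hence i: "i < n" using v by simp
    have "(?B *\<^sub>v v) $ i = of_real (1 / d) * (A *\<^sub>v v) $ i"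
      unfolding mult_mat_vec_index_sum[OF B v(1) i] mult_mat_vec_index_sum[OF A v(1) i]
      using i A by (simp add: sum_divide_distrib)
    hence "of_real d * (k * v $ i) = of_real d * (of_real (1 / d) * (A *\<^sub>v v) $ i)"
      using v i by simp
    also have "\<dots> = (A *\<^sub>v v) $ i" using d0 by simp
    finally show "(A *\<^sub>v v) $ i = ((of_real d * k) \<cdot>\<^sub>v v) $ i"
      using v i by (simp add: mult.assoc)
  qed (use A v in simp)
  hence "of_real d * k \<in> spectrum A"
    using v A unfolding spectrum_def eigenvalue_def eigenvector_def by auto
  hence "norm (of_real d * k) \<le> spectral_radius A"
    using spectral_radius_mem_max(2)[OF A n] by blast
  hence "d * norm k \<le> spectral_radius A" using d0 by (simp add: norm_mult)
  hence "d * norm k < d * 1" using d by linarith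
  thus ?thesis using k(2) d0 by (simp only: mult_less_cancel_left_pos)
qed

lemma nonneg_mat_pow:
  fixes A :: "real mat"
  assumes A: "A \<in> carrier_mat n n" and nonneg: "\<And>i j. i < n \<Longrightarrow> j < n \<Longrightarrow> A $$ (i, j) \<ge> 0"
    and "i < n" "j < n"
  shows "(A ^\<^sub>m k) $$ (i, j) \<ge> 0"
  using assms(3,4)
proof (induction k arbitrary: i j)
  case 0
  thus ?case using A by simp
next
  case (Suc k)
  have "(A ^\<^sub>m Suc k) $$ (i, j) = (\<Sum>l = 0..<n. (A ^\<^sub>m k) $$ (i, l) * A $$ (l, j))"
    using Suc.prems A pow_carrier_mat[OF A, of k] by (simp add: scalar_prod_def)
  also have "\<dots> \<ge> 0"
    using Suc nonneg by (intro sum_nonneg mult_nonneg_nonneg) auto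
  finally show ?case .
qed

text \<open>
  A nonnegative matrix acts monotonically on vectors, so the inequality \<open>q x \<le> A x\<close> can be iterated.
\<close>

lemma mat_pow_supervector:
  fixes A :: "real mat"
  assumes A: "A \<in> carrier_mat n n" and nonneg: "\<And>i j. i < n \<Longrightarrow> j < n \<Longrightarrow> A $$ (i, j) \<ge> 0"
    and x: "x \<in> carrier_vec n" and q: "q \<ge> 0"
    and super: "\<And>i. i < n \<Longrightarrow> q * x $ i \<le> (A *\<^sub>v x) $ i"
    and "i < n"
  shows "q ^ k * x $ i \<le> (A ^\<^sub>m k *\<^sub>v x) $ i"
  using assms(6)
proof (induction k arbitrary: i)
  case 0
  thus ?case using A x by simp
next
  case (Suc k)
  note Ak = pow_carrier_mat[OF A, of k]
  have "q ^ Suc k * x $ i \<le> q * (A ^\<^sub>m k *\<^sub>v x) $ i"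
    using mult_left_mono[OF Suc.IH[OF Suc.prems] q] by (simp add: mult_ac)
  also have "\<dots> = (\<Sum>j = 0..<n. (A ^\<^sub>m k) $$ (i, j) * (q * x $ j))"
    by (simp add: mult_mat_vec_index_sum[OF Ak x Suc.prems] sum_distrib_left mult.left_commute)
  also have "\<dots> \<le> (\<Sum>j = 0..<n. (A ^\<^sub>m k) $$ (i, j) * (A *\<^sub>v x) $ j)"
    using nonneg_mat_pow[OF A nonneg] Suc.prems super
    by (intro sum_mono mult_left_mono) auto
  also have "\<dots> = (A ^\<^sub>m k *\<^sub>v (A *\<^sub>v x)) $ i"
    using A x by (simp add: mult_mat_vec_index_sum[OF Ak _ Suc.prems])
  also have "\<dots> = (A ^\<^sub>m Suc k *\<^sub>v x) $ i"
    using assoc_mult_mat_vec[OF Ak A x] by simp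
  finally show ?case .
qed

text \<open>
  If the spectral radius were below \<open>c\<close>, then dividing \<open>A\<close> by a number \<open>d\<close> strictly between the two
  would give a matrix whose powers stay bounded, as its spectral radius is less than 1. But these
  powers stretch the positive coordinate of \<open>x\<close> by at least \<open>(c / d) ^ k\<close>, which is unbounded.
\<close>

theorem Collatz_Wielandt_lower_bound:
  fixes A :: "real mat"
  assumes A: "A \<in> carrier_mat n n" and nonneg: "\<And>i j. i < n \<Longrightarrow> j < n \<Longrightarrow> A $$ (i, j) \<ge> 0"
    and x: "x \<in> carrier_vec n"
    and super: "\<And>i. i < n \<Longrightarrow> c * x $ i \<le> (A *\<^sub>v x) $ i"
    and i0: "i0 < n" "x $ i0 > 0"
  shows "c \<le> spectral_radius (map_mat complex_of_real A)"
proof (rule ccontr)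
  let ?C = "map_mat complex_of_real A"
  assume "\<not> ?thesis"
  then obtain d where d: "spectral_radius ?C < d" "d < c"
    using dense by (metis not_le)
  have C: "?C \<in> carrier_mat n n" using A by simp
  have n: "n > 0" using i0 by simp
  have d0: "d > 0"
    using spectral_radius_nonneg[OF C n] d(1) by simp
  define B where "B = (1 / d) \<cdot>\<^sub>m A"
  have B: "B \<in> carrier_mat n n" using A by (simp add: B_def)
  have "map_mat complex_of_real B = complex_of_real (1 / d) \<cdot>\<^sub>m ?C"
    by (rule eq_matI) (auto simp: B_def)
  hence "spectral_radius (map_mat complex_of_real B) < 1"
    using spectral_radius_scaled_lt_1[OF C n d(1)] by simp
  then obtain b where b: "\<And>k. norm_bound (map_mat complex_of_real B ^\<^sub>m k) b"
    using spectral_radius_jnf_norm_bound_less_1_upper_triangular[of "map_mat complex_of_real B" n] B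
    by auto
  have entry: "\<bar>(B ^\<^sub>m k) $$ (i, j)\<bar> \<le> b" if "i < n" "j < n" for i j k
  proof -
    have "map_mat complex_of_real B ^\<^sub>m k = map_mat complex_of_real (B ^\<^sub>m k)"
      by (rule of_real_hom.mat_hom_pow[OF B, symmetric])
    hence "norm_bound (map_mat complex_of_real (B ^\<^sub>m k)) b" using b[of k] by simp
    thus ?thesis using that B by (simp add: norm_bound_def del: pow_mat_dim)
  qed
  have nonnegB: "B $$ (i, j) \<ge> 0" if "i < n" "j < n" for i j
    using nonneg[OF that] that A d0 by (simp add: B_def)
  have superB: "c / d * x $ i \<le> (B *\<^sub>v x) $ i" if "i < n" for i
  proof -
    have "(B *\<^sub>v x) $ i = (A *\<^sub>v x) $ i / d"
      unfolding mult_mat_vec_index_sum[OF B x that] mult_mat_vec_index_sum[OF A x that]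
      using that A by (simp add: B_def sum_divide_distrib)
    thus ?thesis using divide_right_mono[OF super[OF that], of d] d0 by simp
  qed
  have bounded: "(c / d) ^ k * x $ i0 \<le> (\<Sum>j = 0..<n. b * \<bar>x $ j\<bar>)" for k
  proof -
    have "(c / d) ^ k * x $ i0 \<le> (B ^\<^sub>m k *\<^sub>v x) $ i0"
      using mat_pow_supervector[OF B nonnegB x _ superB i0(1)] d d0 by simp
    also have "\<dots> = (\<Sum>j = 0..<n. (B ^\<^sub>m k) $$ (i0, j) * x $ j)"
      by (rule mult_mat_vec_index_sum[OF pow_carrier_mat[OF B] x i0(1)])
    also have "\<dots> \<le> (\<Sum>j = 0..<n. \<bar>(B ^\<^sub>m k) $$ (i0, j)\<bar> * \<bar>x $ j\<bar>)"
      by (intro sum_mono) (simp flip: abs_mult)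
    also have "\<dots> \<le> (\<Sum>j = 0..<n. b * \<bar>x $ j\<bar>)"
      using entry i0 by (intro sum_mono mult_right_mono) auto
    finally show ?thesis .
  qed
  have "1 < c / d" using d d0 by simp
  then obtain k where "(\<Sum>j = 0..<n. b * \<bar>x $ j\<bar>) / x $ i0 < (c / d) ^ k"
    using real_arch_pow by blast
  hence "(\<Sum>j = 0..<n. b * \<bar>x $ j\<bar>) < (c / d) ^ k * x $ i0"
    using i0(2) by (simp only: pos_divide_less_eq)
  with bounded[of k] show False by simp
qed

section \<open>Levels in a rooted tree\<close>

context rooted_tree
begin

lemma ex_awalk_from_root:
  assumes "v \<in> pverts T"
  shows "\<exists>p. awalk r p v"
proof -
  have "strongly_connected (with_proj T)"
    using symmetric_connected_imp_strongly_connected[OF sym_arcs connected_tree] .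
  hence "r \<rightarrow>\<^sup>*\<^bsub>with_proj T\<^esub> v"
    using root_in_verts assms unfolding strongly_connected_def by simp
  thus ?thesis using reachable_awalk by simp
qed

lemma level_witness:
  assumes "v \<in> pverts T"
  obtains p where "awalk r p v" "length p = level T r v"
  using LeastI_ex[of "\<lambda>k. \<exists>p. awalk r p v \<and> length p = k"] ex_awalk_from_root[OF assms]
  unfolding level_def by blast

lemma level_le: "awalk r p v \<Longrightarrow> level T r v \<le> length p"
  unfolding level_def by (rule Least_le) blast

lemma level_root: "level T r r = 0"
  using level_le[of "[]" r] root_in_verts by (simp add: awalk_def)

lemma level_ge_1:
  assumes "v \<in> pverts T" "v \<noteq> r"
  shows "level T r v \<ge> 1"
proof -
  obtain p where p: "awalk r p v" "length p = level T r v" using level_witness[OF assms(1)] .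
  hence "p \<noteq> []" using assms(2) by (auto simp: awalk_def)
  thus ?thesis unfolding p(2)[symmetric] by (cases p) auto
qed

lemma level_eq_1_iff:
  assumes "v \<in> pverts T" "v \<noteq> r"
  shows "level T r v = 1 \<longleftrightarrow> (r, v) \<in> parcs T"
proof
  assume 1: "level T r v = 1"
  obtain p where "awalk r p v" "length p = level T r v" using level_witness[OF assms(1)] .
  with 1 obtain e where "awalk r [e] v" by (auto simp: length_Suc_conv)
  hence "e = (r, v)" "e \<in> parcs T" by (auto simp: awalk_def prod_eq_iff)
  thus "(r, v) \<in> parcs T" by simp
next
  assume "(r, v) \<in> parcs T"
  hence "awalk r [(r, v)] v" using root_in_verts by (simp add: awalk_def)
  from level_le[OF this] have "level T r v \<le> 1" by simp
  thus "level T r v = 1" using level_ge_1[OF assms] by simp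
qed

lemma sum_levels_eq: "(\<Sum>v\<in>pverts T. level T r v) = (\<Sum>v\<in>pverts T - {r}. level T r v)"
  using sum.remove[OF pair_finite_verts root_in_verts, of "level T r"] by (simp add: level_root)

lemma card_nonroot: "card (pverts T) - 1 = (\<Sum>v\<in>pverts T - {r}. 1)"
  using root_in_verts pair_finite_verts by simp

lemma sum_levels_ge: "card (pverts T) - 1 \<le> (\<Sum>v\<in>pverts T. level T r v)"
proof -
  have "card (pverts T) - 1 = (\<Sum>v\<in>pverts T - {r}. 1)" by (rule card_nonroot)
  also have "\<dots> \<le> (\<Sum>v\<in>pverts T - {r}. level T r v)"
    using level_ge_1 by (intro sum_mono) auto
  finally show ?thesis by (simp only: sum_levels_eq)
qed

lemma sum_levels_eq_imp_level_1:
  assumes "(\<Sum>v\<in>pverts T. level T r v) = card (pverts T) - 1" "v \<in> pverts T" "v \<noteq> r"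
  shows "level T r v = 1"
proof (rule ccontr)
  assume "level T r v \<noteq> 1"
  hence "level T r v > 1" using level_ge_1[OF assms(2,3)] by simp
  hence "(\<Sum>v\<in>pverts T - {r}. 1) < (\<Sum>v\<in>pverts T - {r}. level T r v)"
    using assms level_ge_1 pair_finite_verts by (intro sum_strict_mono_ex1) auto
  thus False using assms(1) unfolding sum_levels_eq card_nonroot by linarith
qed

section \<open>Bounding the level spectral radius\<close>

lemma ex_enumeration: obtains vs where "distinct vs" "set vs = pverts T"
  using finite_distinct_list[OF pair_finite_verts] by blast

lemma level_matrix_mult_vec:
  assumes vs: "distinct vs" "set vs = pverts T" and i: "i < length vs"
  shows "(level_matrix T r vs *\<^sub>v vec (length vs) (\<lambda>j. f (vs ! j))) $ i
           = (\<Sum>v\<in>pverts T. \<bar>real (level T r (vs ! i)) - real (level T r v)\<bar> * f v)"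
proof -
  have bij: "bij_betw ((!) vs) {0..<length vs} (pverts T)"
    using vs by (simp add: bij_betw_nth atLeast0LessThan)
  show ?thesis
    using i by (simp add: level_matrix_def scalar_prod_def
        sum.reindex_bij_betw[OF bij, of "\<lambda>v. \<bar>real (level T r (vs ! i)) - real (level T r v)\<bar> * f v"])
qed

text \<open>
  The test vector balances the row of the root against the other rows. If it is \<open>t\<close> at the root and 1
  at the other vertices, the root's row allows the factor \<open>s / t\<close> and the other rows allow the factor \<open>t\<close>; both are
  \<open>\<surd>s\<close> for \<open>t = \<surd>s\<close>.
\<close>

theorem sqrt_sum_levels_le_level_spectral_radius:
  "sqrt (\<Sum>v\<in>pverts T. level T r v) \<le> level_spectral_radius T r"
proof -
  define s where "s = real (\<Sum>v\<in>pverts T. level T r v)"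
  define f where "f v = (if v = r then sqrt s else 1)" for v
  have s0: "s \<ge> 0" unfolding s_def by (rule of_nat_0_le_iff)
  obtain vs where vs: "distinct vs" "set vs = pverts T" using ex_enumeration .
  let ?n = "length vs" and ?x = "vec (length vs) (\<lambda>j. f (vs ! j))"
  obtain i0 where i0: "i0 < ?n" "vs ! i0 = r"
    using root_in_verts vs by (metis in_set_conv_nth)
  have A: "map_mat complex_of_real (level_matrix T r vs) \<in> carrier_mat ?n ?n"
    by (simp add: level_matrix_def)
  show ?thesis
  proof (cases "s = 0")
    \<comment> \<open>Only for \<open>s > 0\<close> does \<open>f\<close> have a positive entry at the root.\<close>
    case True
    have "?n > 0" using i0(1) by linarith
    hence "sqrt s \<le> spectral_radius (map_mat complex_of_real (level_matrix T r vs))"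
      using spectral_radius_nonneg[OF A] True by simp
    thus ?thesis unfolding level_spectral_radius_enum[OF vs] s_def .
  next
    case False
    hence s_pos: "s > 0" using s0 by simp
    have "sqrt s \<le> spectral_radius (map_mat complex_of_real (level_matrix T r vs))"
    proof (rule Collatz_Wielandt_lower_bound[where x = ?x and ?i0.0 = i0])
      fix i assume i: "i < ?n"
      have vi: "vs ! i \<in> pverts T" unfolding vs(2)[symmetric] using i by (rule nth_mem)
      have mult: "(level_matrix T r vs *\<^sub>v ?x) $ i
          = (\<Sum>v\<in>pverts T. \<bar>real (level T r (vs ! i)) - real (level T r v)\<bar> * f v)"
        by (rule level_matrix_mult_vec[OF vs i])
      show "sqrt s * ?x $ i \<le> (level_matrix T r vs *\<^sub>v ?x) $ i"
      proof (cases "vs ! i = r")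
        case True
        have "sqrt s * ?x $ i = s" using True i s0 by (simp add: f_def)
        also have "s = (\<Sum>v\<in>pverts T. real (level T r v) * f v)"
          unfolding s_def of_nat_sum by (intro sum.cong) (auto simp: f_def level_root)
        finally show ?thesis by (simp add: mult True level_root)
      next
        case False
        have "sqrt s * ?x $ i = 1 * f r" using False i by (simp add: f_def)
        also have "\<dots> \<le> real (level T r (vs ! i)) * f r"
          using level_ge_1[OF vi False] s0 by (intro mult_right_mono) (auto simp: f_def)
        also have "\<dots> = \<bar>real (level T r (vs ! i)) - real (level T r r)\<bar> * f r"
          by (simp add: level_root)
        also have "\<dots> \<le> (\<Sum>v\<in>pverts T. \<bar>real (level T r (vs ! i)) - real (level T r v)\<bar> * f v)"
          using root_in_verts pair_finite_verts s0
          by (intro member_le_sum[of r]) (auto simp: f_def)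
        finally show ?thesis by (simp only: mult)
      qed
    qed (use i0 s_pos in \<open>auto simp: level_matrix_def f_def\<close>)
    thus ?thesis unfolding level_spectral_radius_enum[OF vs] s_def .
  qed
qed

text \<open>
  If \<open>x\<close> is an eigenvector for \<open>k\<close>, the rows of the leaves say \<open>k x\<^sub>i = x\<^sub>0\<close> and the row of the root
  says \<open>k x\<^sub>0 = \<Sum>\<^sub>i x\<^sub>i\<close>. Multiplying the latter by \<open>k\<close> gives \<open>k\<^sup>2 x\<^sub>0 = (n - 1) x\<^sub>0\<close>; and
  if \<open>x\<^sub>0 = 0\<close>, a leaf with \<open>x\<^sub>i \<noteq> 0\<close> gives \<open>k = 0\<close>. This bounds every eigenvalue by
  \<open>\<surd>(n - 1)\<close>; the converse inequality is the general lower bound. Stated in terms of levels, the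
  result applies to the star itself and to every tree isomorphic to it.
\<close>

theorem level_spectral_radius_of_levels_le_1:
  assumes levels: "\<And>v. v \<in> pverts T \<Longrightarrow> v \<noteq> r \<Longrightarrow> level T r v = 1"
  shows "level_spectral_radius T r = sqrt (real (card (pverts T)) - 1)"
proof (rule antisym)
  \<comment> \<open>The root comes first, so that index 0 is the root and the indices \<open>Suc i\<close> are the leaves.\<close>
  obtain ws where ws: "distinct ws" "set ws = pverts T - {r}"
    using finite_distinct_list[of "pverts T - {r}"] pair_finite_verts by blast
  let ?vs = "r # ws"
  have vs: "distinct ?vs" "set ?vs = pverts T" using ws root_in_verts by auto
  define m where "m = length ws"
  have m: "real m = real (card (pverts T)) - 1"
    using distinct_card[OF vs(1)] vs(2) by (simp add: m_def)
  let ?A = "map_mat complex_of_real (level_matrix T r ?vs)"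
  have A: "?A \<in> carrier_mat (Suc m) (Suc m)" by (simp add: level_matrix_def m_def)
  have lev: "level T r (ws ! j) = 1" if "j < m" for j
    using levels nth_mem[of j ws] that ws by (auto simp: m_def)
  have entry: "?A $$ (i, j) = (if (i = 0) = (j = 0) then 0 else 1)" if "i < Suc m" "j < Suc m" for i j
    using that lev by (cases i; cases j) (auto simp: level_matrix_def m_def level_root)
  obtain k where k: "k \<in> spectrum ?A" "spectral_radius ?A = norm k"
    using spectral_radius_mem_max(1)[OF A] by auto
  then obtain x where x: "x \<in> carrier_vec (Suc m)" "x \<noteq> 0\<^sub>v (Suc m)" "?A *\<^sub>v x = k \<cdot>\<^sub>v x"
    using A unfolding spectrum_def eigenvalue_def eigenvector_def by auto
  have row: "k * x $ i = (\<Sum>j = 0..<Suc m. ?A $$ (i, j) * x $ j)" if "i < Suc m" for i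
  proof -
    have "k * x $ i = (?A *\<^sub>v x) $ i" using x that by (simp del: sum.op_ivl_Suc)
    thus ?thesis by (simp only: mult_mat_vec_index_sum[OF A x(1) that])
  qed
  have leaf: "k * x $ Suc i = x $ 0" if "i < m" for i
  proof -
    have "k * x $ Suc i = (\<Sum>j = 0..<Suc m. if j = 0 then x $ 0 else 0)"
      unfolding row[OF Suc_mono[OF that]] using that by (intro sum.cong) (auto simp: entry)
    thus ?thesis by simp
  qed
  have root: "k * x $ 0 = (\<Sum>i<m. x $ Suc i)"
  proof -
    have "k * x $ 0 = (\<Sum>j = 0..<Suc m. ?A $$ (0, j) * x $ j)" by (rule row) simp
    also have "\<dots> = (\<Sum>i<m. ?A $$ (0, Suc i) * x $ Suc i)"
      by (simp only: atLeast0LessThan sum.lessThan_Suc_shift) (simp add: entry)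
    also have "\<dots> = (\<Sum>i<m. x $ Suc i)" by (intro sum.cong) (auto simp: entry)
    finally show ?thesis .
  qed
  have "norm k \<le> sqrt m"
  proof (cases "x $ 0 = 0")
    case True
    have "\<exists>i<Suc m. x $ i \<noteq> 0"
    proof (rule ccontr)
      assume "\<not> ?thesis"
      hence "x = 0\<^sub>v (Suc m)" using x(1) by (intro eq_vecI) auto
      with x(2) show False by simp
    qed
    then obtain i where "i < m" "x $ Suc i \<noteq> 0" using True by (metis less_Suc_eq_0_disj)
    hence "k = 0" using leaf[of i] True by simp
    thus ?thesis by simp
  next
    case False
    have "k ^ 2 * x $ 0 = (\<Sum>i<m. k * x $ Suc i)"
      by (simp add: power2_eq_square root mult.assoc sum_distrib_left)
    also have "\<dots> = of_nat m * x $ 0" by (simp add: leaf)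
    finally have "k ^ 2 = of_nat m" using False by simp
    hence "norm k ^ 2 = real m" by (metis norm_of_nat norm_power)
    thus ?thesis by (metis norm_ge_zero real_sqrt_unique order_refl)
  qed
  thus "level_spectral_radius T r \<le> sqrt (real (card (pverts T)) - 1)"
    unfolding level_spectral_radius_enum[OF vs] k(2) m .
next
  have "real (card (pverts T)) - 1 \<le> real (\<Sum>v\<in>pverts T. level T r v)"
    using sum_levels_ge by linarith
  thus "sqrt (real (card (pverts T)) - 1) \<le> level_spectral_radius T r"
    using sqrt_sum_levels_le_level_spectral_radius real_sqrt_le_mono order_trans by blast
qed

section \<open>Recognising the rooted star\<close>

lemma no_triangle:
  assumes "(u, v) \<in> parcs T" "(v, w) \<in> parcs T" "(w, u) \<in> parcs T"
  shows False
proof -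
  have "u \<noteq> v" "v \<noteq> w" "w \<noteq> u" using assms no_loops' by blast+
  hence "cycle [(u, v), (v, w), (w, u)]"
    using assms in_arcsD1 unfolding cycle_def awalk_def by (intro exI[of _ u]) auto
  thus False using no_cycles by force
qed

text \<open>
  All non-root vertices are adjacent to the root. An edge between two of them would therefore close a
  triangle through the root.
\<close>

lemma parcs_of_levels_le_1:
  assumes levels: "\<And>v. v \<in> pverts T \<Longrightarrow> v \<noteq> r \<Longrightarrow> level T r v = 1"
  shows "parcs T = {r} \<times> (pverts T - {r}) \<union> (pverts T - {r}) \<times> {r}"
proof -
  have root_arc: "(r, v) \<in> parcs T" "(v, r) \<in> parcs T" if "v \<in> pverts T" "v \<noteq> r" for v
  proof -
    show "(r, v) \<in> parcs T" using levels level_eq_1_iff that by blast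
    thus "(v, r) \<in> parcs T" using sym_arcs unfolding symmetric_def by (auto dest: symD)
  qed
  have incident_root: "u = r \<or> v = r" if "(u, v) \<in> parcs T" for u v
    using no_triangle[OF _ that] root_arc in_arcsD1[OF that] in_arcsD2[OF that] by blast
  have ends: "u \<in> pverts T \<and> v \<in> pverts T \<and> u \<noteq> v" if "(u, v) \<in> parcs T" for u v
    using in_arcsD1[OF that] in_arcsD2[OF that] no_loops'[OF that] by simp
  show ?thesis
  proof (intro equalityI subrelI)
    fix u v assume "(u, v) \<in> parcs T"
    from incident_root[OF this] ends[OF this]
    show "(u, v) \<in> {r} \<times> (pverts T - {r}) \<union> (pverts T - {r}) \<times> {r}" by blast
  qed (use root_arc in blast)
qed

text \<open>
  From left to right, the edge from 0 to the image of \<open>v\<close> in the star comes from an edge of \<open>T\<close>, whose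
  ends must be \<open>r\<close> and \<open>v\<close> by injectivity on vertices. From right to left, the edge set is already
  determined by the vertex set and the root, so every bijection of the vertices that sends the root to
  0 is an isomorphism.
\<close>

theorem rooted_iso_star_iff:
  "rooted_iso T r (rooted_star (card (pverts T))) 0 \<longleftrightarrow>
     (\<forall>v\<in>pverts T. v \<noteq> r \<longrightarrow> level T r v = 1)"
proof
  assume "rooted_iso T r (rooted_star (card (pverts T))) 0"
  then obtain h where h: "digraph_isomorphism h"
    and app: "with_proj (rooted_star (card (pverts T))) = app_iso h (with_proj T)"
    and h_r: "iso_verts h r = 0"
    unfolding rooted_iso_def by auto
  let ?S = "rooted_star (card (pverts T))"
  have verts: "pverts ?S = iso_verts h ` pverts T" and arcs: "parcs ?S = iso_arcs h ` parcs T"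
    and ends: "iso_tail h = fst" "iso_head h = snd"
    using arg_cong[OF app, of verts] arg_cong[OF app, of arcs]
      arg_cong[OF app, of tail] arg_cong[OF app, of head] by simp_all
  have inj: "inj_on (iso_verts h) (pverts T)"
    using h by (simp add: digraph_isomorphism_def)
  show "\<forall>v\<in>pverts T. v \<noteq> r \<longrightarrow> level T r v = 1"
  proof (intro ballI impI)
    fix v assume v: "v \<in> pverts T" "v \<noteq> r"
    have "iso_verts h v \<noteq> 0" using inj v root_in_verts h_r by (metis inj_on_eq_iff)
    moreover have "iso_verts h v \<in> pverts ?S" using v verts by blast
    ultimately have "(0, iso_verts h v) \<in> parcs ?S" by (auto simp: rooted_star_def)
    then obtain e where e: "e \<in> parcs T" "iso_arcs h e = (0, iso_verts h v)"
      using arcs by (metis imageE)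
    hence "iso_verts h (fst e) = iso_verts h r" "iso_verts h (snd e) = iso_verts h v"
      using h ends h_r by (auto simp: digraph_isomorphism_def)
    hence "fst e = r" "snd e = v"
      using inj e(1) v root_in_verts arc_fst_in_verts arc_snd_in_verts by (meson inj_onD)+
    hence "(r, v) \<in> parcs T" using e(1) by (metis prod.collapse)
    thus "level T r v = 1" using level_eq_1_iff[OF v] by simp
  qed
next
  assume "\<forall>v\<in>pverts T. v \<noteq> r \<longrightarrow> level T r v = 1"
  hence parcs: "parcs T = {r} \<times> (pverts T - {r}) \<union> (pverts T - {r}) \<times> {r}"
    by (intro parcs_of_levels_le_1) auto
  let ?n = "card (pverts T)"
  obtain g where g: "bij_betw g (pverts T - {r}) {1..<?n}"
    using finite_same_card_bij[of "pverts T - {r}" "{1..<?n}"] pair_finite_verts root_in_verts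
    by auto
  define f where "f v = (if v = r then 0 else g v)" for v
  have f_r: "f r = 0" by (simp add: f_def)
  have fg: "f ` (pverts T - {r}) = {1..<?n}"
    using g unfolding bij_betw_def f_def by auto
  have n: "?n > 0" using root_in_verts pair_finite_verts card_gt_0_iff by blast
  have f_img: "f ` pverts T = {0..<?n}"
  proof -
    have "f ` pverts T = insert (f r) (f ` (pverts T - {r}))" using root_in_verts by blast
    thus ?thesis using n by (auto simp: f_r fg)
  qed
  have inj: "inj_on f (pverts T)"
    using f_img pair_finite_verts by (intro eq_card_imp_inj_on) auto
  define h where "h = \<lparr>iso_verts = f, iso_arcs = map_prod f f, iso_head = snd, iso_tail = fst\<rparr>"
  have "inj_on (map_prod f f) (parcs T)"
    by (rule inj_on_subset[OF map_prod_inj_on[OF inj inj]]) (use in_arcsD1 in_arcsD2 in auto)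
  hence "digraph_isomorphism h"
    using inj wf_digraph_axioms by (simp add: digraph_isomorphism_def h_def)
  moreover have "parcs (rooted_star ?n) = map_prod f f ` parcs T"
  proof -
    have "map_prod f f ` (X \<times> Y) = f ` X \<times> f ` Y" for X Y by force
    thus ?thesis by (simp add: parcs image_Un rooted_star_def f_r fg)
  qed
  hence "with_proj (rooted_star ?n) = app_iso h (with_proj T)"
    by (intro pre_digraph.equality) (auto simp: h_def f_img rooted_star_def)
  moreover have "iso_verts h r = 0" by (simp add: h_def f_r)
  ultimately show "rooted_iso T r (rooted_star ?n) 0" unfolding rooted_iso_def by blast
qed

end

lemma level_spectral_radius_rooted_star:
  assumes "n \<ge> 1"
  shows "level_spectral_radius (rooted_star n) 0 = sqrt (real n - 1)"
proof -
  interpret rooted_tree "rooted_star n" 0 by (rule rooted_tree_rooted_star[OF assms])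
  have "level (rooted_star n) 0 v = 1" if "v \<in> pverts (rooted_star n)" "v \<noteq> 0" for v
    using that level_eq_1_iff[OF that] by (auto simp: rooted_star_def)
  thus ?thesis using level_spectral_radius_of_levels_le_1 by (simp add: card_rooted_star)
qed

theorem theorem5:
  fixes n :: nat
  assumes "n \<ge> 1"
  shows "(\<forall>(T :: 'a pair_pre_digraph) r. rooted_tree T r \<and> card (pverts T) = n \<longrightarrow>
            level_spectral_radius T r \<ge> level_spectral_radius (rooted_star n) 0 \<and>
            (level_spectral_radius T r = level_spectral_radius (rooted_star n) 0
               \<longleftrightarrow> rooted_iso T r (rooted_star n) 0)) \<and>
         level_spectral_radius (rooted_star n) 0 = sqrt (real n - 1)"
proof (intro conjI allI impI)
  fix T :: "'a pair_pre_digraph" and r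
  assume T: "rooted_tree T r \<and> card (pverts T) = n"
  then interpret rooted_tree T r by simp
  have n: "card (pverts T) = n" using T by simp
  define s where "s = (\<Sum>v\<in>pverts T. level T r v)"
  have s: "n - 1 \<le> s" using sum_levels_ge n by (simp add: s_def)
  have lower: "sqrt (real s) \<le> level_spectral_radius T r"
    using sqrt_sum_levels_le_level_spectral_radius by (simp add: s_def)
  have "sqrt (real n - 1) \<le> sqrt (real s)" using s assms by simp
  from order_trans[OF this lower]
  show "level_spectral_radius T r \<ge> level_spectral_radius (rooted_star n) 0"
    by (simp only: level_spectral_radius_rooted_star[OF assms])
  have "level_spectral_radius T r = sqrt (real n - 1) \<longleftrightarrow>
      (\<forall>v\<in>pverts T. v \<noteq> r \<longrightarrow> level T r v = 1)"
  proof
    assume "level_spectral_radius T r = sqrt (real n - 1)"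
    hence "real s \<le> real n - 1" using lower by simp
    hence "s = card (pverts T) - 1" using s n assms by linarith
    thus "\<forall>v\<in>pverts T. v \<noteq> r \<longrightarrow> level T r v = 1"
      using sum_levels_eq_imp_level_1 unfolding s_def by blast
  next
    assume "\<forall>v\<in>pverts T. v \<noteq> r \<longrightarrow> level T r v = 1"
    thus "level_spectral_radius T r = sqrt (real n - 1)"
      using level_spectral_radius_of_levels_le_1 unfolding n by blast
  qed
  thus "level_spectral_radius T r = level_spectral_radius (rooted_star n) 0
      \<longleftrightarrow> rooted_iso T r (rooted_star n) 0"
    unfolding rooted_iso_star_iff[unfolded n] level_spectral_radius_rooted_star[OF assms] .
qed (rule level_spectral_radius_rooted_star[OF assms])

end
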